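(* Assume that $f$ is continuously differentiable with $L_f$-Lipschitz continuous gradient ($L_f\ge 0$), that the level set $\{x\in\mathbb{R}^n : F(x)\le F(x^0,\epsilon^0)\}$ is bounded, and that for all $k\in\mathbb{N}$ one has $\nabla Q_k(x^k)=\nabla f(x^k)$, $Q_k$ is strongly convex with constant $M>L_f/2$, $M>0$, and $\nabla Q_k$ is Lipschitz continuous with constant $L>0$ ($M$ and $L$ independent of $k$). Let $\{x^k\}$ be a sequence generated by the IRL1 algorithm. Then there exists $\bar k\in\mathbb{N}$ such that the sign of $x^k$ is fixed for all $k>\bar k$; i.e., there is $s\in\{-1,0,+1\}^n$ with $\mathrm{sign}(x^k)=s$ for all $k>\bar k$.
   Context: Let $p\in(0,1)$, $\lambda>0$, $f:\mathbb{R}^n\to\mathbb{R}$ continuously differentiable, $F(x)=f(x)+\lambda\sum_{i=1}^n|x_i|^p$, and for $\epsilon\in\mathbb{R}^n_{++}$ let $F(x,\epsilon)=f(x)+\lambda\sum_{i=1}^n(|x_i|+\epsilon_i)^p$. For $x\in\mathbb{R}^n$, $\mathrm{sign}(x)\in\{-1,0,+1\}^n$ is the componentwise sign (with $\mathrm{sign}(0)=0$). IRL1 algorithm (iteratively reweighted $\ell_1$): given $\mu\in(0,1)$, $x^0\in\mathbb{R}^n$, $\epsilon^0\in\mathbb{R}^n_{++}$, for $k=0,1,2,\dots$ set the weights $w_i^k=w(x_i^k,\epsilon_i^k)=p(|x_i^k|+\epsilon_i^k)^{p-1}$, $i=1,\dots,n$; choose a smooth convex local model $Q_k:\mathbb{R}^n\to\mathbb{R}$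 of $f$ at $x^k$; set $x^{k+1}=\arg\min_{x\in\mathbb{R}^n}\{Q_k(x)+\lambda\sum_{i=1}^n w_i^k|x_i|\}$; choose $\epsilon^{k+1}\in\mathbb{R}^n_{++}$ with $\epsilon^{k+1}\le\mu\epsilon^k$ componentwise. *)

theory Defs
  imports "HOL-Analysis.Analysis"
begin

definition has_continuous_gradient ::
    "('a::real_inner \<Rightarrow> real) \<Rightarrow> ('a \<Rightarrow> 'a) \<Rightarrow> bool" where
  "has_continuous_gradient f g \<longleftrightarrow>
     (\<forall>x. GDERIV f x :> g x) \<and> continuous_on UNIV g"

text \<open>Strong convexity with modulus \<open>m\<close>, in the normalisation in which a differentiable
  function satisfies \<open>f y \<ge> f x + inner (grad f x) (y - x) + m / 2 * (norm (y - x))^2\<close>.\<close>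

definition strongly_convex_on ::
    "'a::real_normed_vector set \<Rightarrow> real \<Rightarrow> ('a \<Rightarrow> real) \<Rightarrow> bool" where
  "strongly_convex_on S m f \<longleftrightarrow> convex S \<and>
     (\<forall>x\<in>S. \<forall>y\<in>S. \<forall>t\<in>{0..1}.
        f ((1 - t) *\<^sub>R x + t *\<^sub>R y)
          \<le> (1 - t) * f x + t * f y - m / 2 * t * (1 - t) * (norm (x - y))\<^sup>2)"

text \<open>For \<open>p > 0\<close> the convention \<open>0 powr p = 0\<close> gives the right value at zero components.\<close>

definition lp_objective ::
    "(real^'n \<Rightarrow> real) \<Rightarrow> real \<Rightarrow> real \<Rightarrow> real^'n \<Rightarrow> real" where
  "lp_objective f lam p x = f x + lam * (\<Sum>i\<in>UNIV. \<bar>x $ i\<bar> powr p)"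

definition lp_objective_eps ::
    "(real^'n \<Rightarrow> real) \<Rightarrow> real \<Rightarrow> real \<Rightarrow> real^'n \<Rightarrow> real^'n \<Rightarrow> real" where
  "lp_objective_eps f lam p x e =
     f x + lam * (\<Sum>i\<in>UNIV. (\<bar>x $ i\<bar> + e $ i) powr p)"

definition irl1_weight :: "real \<Rightarrow> real \<Rightarrow> real \<Rightarrow> real" where
  "irl1_weight p t e = p * (\<bar>t\<bar> + e) powr (p - 1)"

text \<open>Not \<open>sgn\<close> on \<open>real^'n\<close>, which is the normalised vector \<open>x /\<^sub>R norm x\<close>.\<close>

definition sign_vec :: "real^'n \<Rightarrow> real^'n" where
  "sign_vec x = (\<chi> i. sgn (x $ i))"

text \<open>\<open>x\<close> and \<open>e\<close> are a run of IRL1 with shrinking factor \<open>mu\<close>, where \<open>Q k\<close>, with gradient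
  \<open>gQ k\<close>, is the model chosen in iteration \<open>k\<close>. How \<open>Q k\<close> approximates the smooth term
  at \<open>x k\<close> is not part of the algorithm, so \<open>f\<close> does not occur here.\<close>

definition irl1_sequence ::
    "real \<Rightarrow> real \<Rightarrow> real \<Rightarrow> (nat \<Rightarrow> real^'n \<Rightarrow> real) \<Rightarrow> (nat \<Rightarrow> real^'n \<Rightarrow> real^'n) \<Rightarrow>
     (nat \<Rightarrow> real^'n) \<Rightarrow> (nat \<Rightarrow> real^'n) \<Rightarrow> bool" where
  "irl1_sequence lam p mu Q gQ x e \<longleftrightarrow>
     0 < mu \<and> mu < 1 \<and>
     (\<forall>i. 0 < e 0 $ i) \<and>
     (\<forall>k.
        has_continuous_gradient (Q k) (gQ k) \<and> convex_on UNIV (Q k) \<and>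
        is_arg_min
          (\<lambda>y. Q k y + lam * (\<Sum>i\<in>UNIV. irl1_weight p (x k $ i) (e k $ i) * \<bar>y $ i\<bar>))
          (\<lambda>y. True) (x (Suc k)) \<and>
        (\<forall>i. 0 < e (Suc k) $ i \<and> e (Suc k) $ i \<le> mu * e k $ i))"

end

theory Submission
  imports Defs
begin

text \<open>
  Two facts force the signs to stabilise.

  \<^item> The steps vanish. Tangents of the concave function \<open>t \<mapsto> t powr p\<close> lie above its graph, so the
    weighted \<open>l1\<close> term overestimates the change of the smoothed regulariser; together with
    the quadratic growth of the strongly convex subproblem and the Lipschitz bound on the gradient
    of \<open>f\<close>, one iteration lowers the smoothed objective by at least
    \<open>(M - Lf / 2) * (norm (x (Suc k) - x k))\<^sup>2\<close> (\<open>irl1_step_decrease\<close>). Hence the iterates stay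
    in the bounded level set, where the objective is bounded below, and the decreases, and with
    them the step lengths, tend to \<open>0\<close>.

  \<^item> A component can stay nonzero only if it was already large. If \<open>x (Suc k) $ i\<close> is nonzero,
    comparing \<open>x (Suc k)\<close> with the vector whose component \<open>i\<close> is zeroed bounds \<open>lam\<close> times the weight
    by the norm of a gradient of the model (\<open>l1_minimizer_nonzero_weight_bound\<close>), and those gradients are
    uniformly bounded along the run. Since the weight \<open>p * (\<bar>x k $ i\<bar> + e k $ i) powr (p - 1)\<close>
    blows up near zero, this gives \<open>\<delta> \<le> \<bar>x k $ i\<bar> + e k $ i\<close> for a fixed \<open>\<delta> > 0\<close>.

  As soon as \<open>e k $ i\<close> and the step length are below \<open>\<delta> / 2\<close>, a nonzero \<open>x (Suc k) $ i\<close> therefore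
  has the sign of \<open>x k $ i\<close>: the only possible change of sign is to zero, and zero is then
  permanent. Such a change occurs at most once in each component.
\<close>

section \<open>Differentiable, strongly convex functions\<close>

lemma has_continuous_gradient_directional:
  fixes f :: "'a::real_inner \<Rightarrow> real"
  assumes "has_continuous_gradient f g"
  shows "((\<lambda>t. f (x + t *\<^sub>R v)) has_real_derivative inner v (g (x + t *\<^sub>R v))) (at t)"
proof -
  have "(f has_derivative (\<lambda>h. inner h (g (x + t *\<^sub>R v)))) (at (x + t *\<^sub>R v))"
    using assms by (simp add: has_continuous_gradient_def gderiv_def)
  then have "((\<lambda>t. f (x + t *\<^sub>R v)) has_derivative (\<lambda>s. inner (s *\<^sub>R v) (g (x + t *\<^sub>R v)))) (at t)"
    by (rule has_derivative_compose[rotated]) (auto intro!: derivative_eq_intros)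
  then show ?thesis
    by (simp add: has_field_derivative_def mult_commute_abs)
qed

lemma has_continuous_gradient_imp_continuous_on:
  fixes f :: "'a::real_inner \<Rightarrow> real"
  assumes "has_continuous_gradient f g"
  shows "continuous_on S f"
  using assms unfolding has_continuous_gradient_def gderiv_def
  by (meson continuous_at_imp_continuous_on has_derivative_continuous)

text \<open>Along the segment from \<open>x\<close> to \<open>y\<close> the gradient deviates from \<open>g x\<close> at parameter \<open>t\<close> by at
  most \<open>K * t * norm (y - x)\<close>, so subtracting the claimed upper bound from \<open>f\<close> leaves a function
  of \<open>t\<close> with nonpositive derivative.\<close>

lemma lipschitz_gradient_upper_bound:
  fixes f :: "'a::real_inner \<Rightarrow> real"
  assumes grad: "has_continuous_gradient f g" and lip: "lipschitz_on K UNIV g"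
  shows "f y \<le> f x + inner (g x) (y - x) + K / 2 * (norm (y - x))\<^sup>2"
proof -
  define v where "v = y - x"
  define h where "h t = f (x + t *\<^sub>R v) - t * inner (g x) v - K / 2 * t\<^sup>2 * (norm v)\<^sup>2" for t
  have "h 1 \<le> h 0"
  proof (rule DERIV_nonpos_imp_nonincreasing[of 0 1 h])
    fix t :: real assume t: "0 \<le> t" "t \<le> 1"
    let ?D = "inner v (g (x + t *\<^sub>R v)) - inner (g x) v - K * t * (norm v)\<^sup>2"
    have "(h has_real_derivative ?D) (at t)"
      unfolding h_def
      by (rule derivative_eq_intros has_continuous_gradient_directional[OF grad] refl | simp)+
    moreover have "?D \<le> 0"
    proof -
      have "inner v (g (x + t *\<^sub>R v)) - inner (g x) v = inner v (g (x + t *\<^sub>R v) - g x)"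
        by (simp add: inner_diff_right inner_commute)
      also have "\<dots> \<le> norm v * norm (g (x + t *\<^sub>R v) - g x)"
        by (rule norm_cauchy_schwarz)
      also have "\<dots> \<le> norm v * (K * norm (t *\<^sub>R v))"
        using lipschitz_onD[OF lip, of "x + t *\<^sub>R v" x]
        by (intro mult_left_mono) (auto simp: dist_norm)
      also have "\<dots> = K * t * (norm v)\<^sup>2"
        using t by (simp add: power2_eq_square)
      finally show ?thesis by simp
    qed
    ultimately show "\<exists>d. (h has_real_derivative d) (at t) \<and> d \<le> 0" by blast
  qed simp
  then show ?thesis by (simp add: h_def v_def)
qed

text \<open>Strong convexity bounds the difference quotient of \<open>f\<close> at parameter \<open>t\<close> by
  \<open>f y - f x - m / 2 * (1 - t) * (norm (y - x))\<^sup>2\<close>; the claim is the limit as \<open>t\<close> tends to \<open>0\<close>.\<close>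

lemma strongly_convex_gradient_inequality:
  fixes f :: "'a::real_inner \<Rightarrow> real"
  assumes sc: "strongly_convex_on UNIV m f" and grad: "has_continuous_gradient f g"
  shows "f x + inner (g x) (y - x) + m / 2 * (norm (y - x))\<^sup>2 \<le> f y"
proof -
  define v where "v = y - x"
  have "((\<lambda>t. f (x + t *\<^sub>R v)) has_real_derivative inner v (g x)) (at 0)"
    using has_continuous_gradient_directional[OF grad, of x v 0] by simp
  then have lim: "((\<lambda>t. (f (x + t *\<^sub>R v) - f x) / t) \<longlongrightarrow> inner v (g x)) (at_right 0)"
    by (simp add: DERIV_def filterlim_at_split)
  have lim': "((\<lambda>t. f y - f x - m / 2 * (1 - t) * (norm v)\<^sup>2)
      \<longlongrightarrow> f y - f x - m / 2 * (1 - 0) * (norm v)\<^sup>2) (at_right 0)"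
    by (intro tendsto_intros)
  have "\<forall>\<^sub>F t in at_right 0. (f (x + t *\<^sub>R v) - f x) / t \<le> f y - f x - m / 2 * (1 - t) * (norm v)\<^sup>2"
    using eventually_at_right_real[of 0 1, OF zero_less_one]
  proof eventually_elim
    case (elim t)
    have "f ((1 - t) *\<^sub>R x + t *\<^sub>R y)
        \<le> (1 - t) * f x + t * f y - m / 2 * t * (1 - t) * (norm (x - y))\<^sup>2"
      using sc elim by (auto simp: strongly_convex_on_def)
    moreover have "(1 - t) *\<^sub>R x + t *\<^sub>R y = x + t *\<^sub>R v"
      by (simp add: v_def algebra_simps)
    ultimately have "f (x + t *\<^sub>R v) - f x \<le> t * (f y - f x - m / 2 * (1 - t) * (norm v)\<^sup>2)"
      by (simp add: v_def norm_minus_commute algebra_simps)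
    then show ?case using elim by (simp add: divide_le_eq mult.commute)
  qed
  from tendsto_le[OF _ lim' lim this] show ?thesis
    by (simp add: v_def inner_commute)
qed

text \<open>Comparing the minimal value with the value at parameter \<open>t\<close> of the segment from \<open>y\<close> to \<open>z\<close>
  gives the claim with the factor \<open>1 - t\<close> in the quadratic term, for every \<open>t\<close> between \<open>0\<close> and \<open>1\<close>.\<close>

lemma strongly_convex_quadratic_growth_at_minimizer:
  assumes sc: "strongly_convex_on UNIV m h" and min: "is_arg_min h (\<lambda>_. True) y"
  shows "h y + m / 2 * (norm (z - y))\<^sup>2 \<le> (h z :: real)"
proof -
  have lim: "((\<lambda>t. h z - m / 2 * (1 - t) * (norm (z - y))\<^sup>2)
      \<longlongrightarrow> h z - m / 2 * (1 - 0) * (norm (z - y))\<^sup>2) (at_right 0)"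
    by (intro tendsto_intros)
  have "\<forall>\<^sub>F t in at_right 0. h y \<le> h z - m / 2 * (1 - t) * (norm (z - y))\<^sup>2"
    using eventually_at_right_real[of 0 1, OF zero_less_one]
  proof eventually_elim
    case (elim t)
    have "h y \<le> h ((1 - t) *\<^sub>R y + t *\<^sub>R z)"
      using min by (auto simp: is_arg_min_linorder)
    also have "\<dots> \<le> (1 - t) * h y + t * h z - m / 2 * t * (1 - t) * (norm (y - z))\<^sup>2"
      using sc elim by (auto simp: strongly_convex_on_def)
    finally have "t * h y \<le> t * (h z - m / 2 * (1 - t) * (norm (z - y))\<^sup>2)"
      by (simp add: norm_minus_commute algebra_simps)
    then show ?case using elim by simp
  qed
  from tendsto_lowerbound[OF lim this] show ?thesis by simp
qed

section \<open>Weighted \<open>l1\<close> subproblems\<close>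

lemma strongly_convex_on_add_convex:
  assumes "strongly_convex_on S m f" and "convex_on S g"
  shows "strongly_convex_on S m (\<lambda>x. f x + g x)"
  unfolding strongly_convex_on_def
proof (intro conjI ballI)
  show "convex S" using assms(1) by (simp add: strongly_convex_on_def)
  fix x y and t :: real assume *: "x \<in> S" "y \<in> S" "t \<in> {0..1}"
  then have "f ((1 - t) *\<^sub>R x + t *\<^sub>R y)
      \<le> (1 - t) * f x + t * f y - m / 2 * t * (1 - t) * (norm (x - y))\<^sup>2"
    using assms(1) by (simp add: strongly_convex_on_def)
  moreover have "g ((1 - t) *\<^sub>R x + t *\<^sub>R y) \<le> (1 - t) * g x + t * g y"
    using convex_onD[OF assms(2)] * by simp
  ultimately show "f ((1 - t) *\<^sub>R x + t *\<^sub>R y) + g ((1 - t) *\<^sub>R x + t *\<^sub>R y)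
      \<le> (1 - t) * (f x + g x) + t * (f y + g y) - m / 2 * t * (1 - t) * (norm (x - y))\<^sup>2"
    by (simp add: algebra_simps)
qed

lemma convex_on_weighted_l1:
  fixes w :: "'n::finite \<Rightarrow> real"
  assumes lam: "0 \<le> lam" and w: "\<And>i. 0 \<le> w i"
  shows "convex_on UNIV (\<lambda>y :: real^'n. lam * (\<Sum>i\<in>UNIV. w i * \<bar>y $ i\<bar>))"
proof (rule convex_onI)
  fix t :: real and x y :: "real^'n" assume t: "0 < t" "t < 1"
  have "(\<Sum>i\<in>UNIV. w i * \<bar>((1 - t) *\<^sub>R x + t *\<^sub>R y) $ i\<bar>)
      \<le> (\<Sum>i\<in>UNIV. w i * ((1 - t) * \<bar>x $ i\<bar> + t * \<bar>y $ i\<bar>))"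
  proof (intro sum_mono mult_left_mono w)
    fix i
    have "\<bar>(1 - t) * x $ i + t * y $ i\<bar> \<le> \<bar>(1 - t) * x $ i\<bar> + \<bar>t * y $ i\<bar>"
      by (rule abs_triangle_ineq)
    then show "\<bar>((1 - t) *\<^sub>R x + t *\<^sub>R y) $ i\<bar> \<le> (1 - t) * \<bar>x $ i\<bar> + t * \<bar>y $ i\<bar>"
      using t by (simp add: abs_mult)
  qed
  also have "\<dots> = (1 - t) * (\<Sum>i\<in>UNIV. w i * \<bar>x $ i\<bar>) + t * (\<Sum>i\<in>UNIV. w i * \<bar>y $ i\<bar>)"
    by (simp add: sum_distrib_left sum.distrib sum_subtractf algebra_simps)
  finally show "lam * (\<Sum>i\<in>UNIV. w i * \<bar>((1 - t) *\<^sub>R x + t *\<^sub>R y) $ i\<bar>)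
      \<le> (1 - t) * (lam * (\<Sum>i\<in>UNIV. w i * \<bar>x $ i\<bar>)) + t * (lam * (\<Sum>i\<in>UNIV. w i * \<bar>y $ i\<bar>))"
    using mult_left_mono[OF _ lam] by (fastforce simp: algebra_simps)
qed simp

text \<open>Zeroing the component \<open>i\<close> saves \<open>lam * w i * \<bar>y $ i\<bar>\<close> in the \<open>l1\<close> term, while by convexity
  \<open>Q\<close> increases by at most \<open>norm (gQ z) * \<bar>y $ i\<bar>\<close>, where \<open>z\<close> is the zeroed vector. Evaluating the
  gradient at \<open>z\<close>, not at \<open>y\<close>, makes this single comparison enough, with no one-sided derivative
  of the absolute value.\<close>

lemma l1_minimizer_nonzero_weight_bound:
  fixes Q :: "real^'n \<Rightarrow> real"
  assumes sc: "strongly_convex_on UNIV m Q" and m: "0 \<le> m"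
    and grad: "has_continuous_gradient Q gQ"
    and min: "is_arg_min (\<lambda>y. Q y + lam * (\<Sum>i\<in>UNIV. w i * \<bar>y $ i\<bar>)) (\<lambda>_. True) y"
    and nz: "y $ i \<noteq> 0"
  obtains z where "norm z \<le> norm y" "lam * w i \<le> norm (gQ z)"
proof
  define z where "z = y - axis i (y $ i)"
  have z: "z $ j = (if j = i then 0 else y $ j)" for j
    by (simp add: z_def axis_def)
  show "norm z \<le> norm y"
    by (rule norm_le_componentwise_cart) (simp add: z)
  have "(\<Sum>j\<in>UNIV. w j * \<bar>y $ j\<bar>) - (\<Sum>j\<in>UNIV. w j * \<bar>z $ j\<bar>) = w i * \<bar>y $ i\<bar>"
    by (simp add: sum.remove[of UNIV i] z)
  moreover have "Q y + lam * (\<Sum>j\<in>UNIV. w j * \<bar>y $ j\<bar>) \<le> Q z + lam * (\<Sum>j\<in>UNIV. w j * \<bar>z $ j\<bar>)"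
    using min by (auto simp: is_arg_min_linorder)
  ultimately have "lam * w i * \<bar>y $ i\<bar> \<le> Q z - Q y"
    by (smt (verit) mult.assoc right_diff_distrib)
  also have "\<dots> \<le> inner (gQ z) (z - y)"
  proof -
    have "Q z + inner (gQ z) (y - z) + m / 2 * (norm (y - z))\<^sup>2 \<le> Q y"
      by (rule strongly_convex_gradient_inequality[OF sc grad])
    moreover have "0 \<le> m / 2 * (norm (y - z))\<^sup>2" using m by simp
    ultimately show ?thesis by (simp add: inner_diff_right)
  qed
  also have "\<dots> \<le> norm (gQ z) * norm (z - y)"
    by (rule norm_cauchy_schwarz)
  also have "\<dots> = norm (gQ z) * \<bar>y $ i\<bar>"
    by (simp add: z_def norm_eq_sqrt_inner[of "axis _ _"] inner_axis_axis flip: power2_eq_square)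
  finally show "lam * w i \<le> norm (gQ z)"
    using nz by simp
qed

section \<open>Decrease of the smoothed objective\<close>

text \<open>Up to the factor \<open>a powr (p - 1)\<close> this is the weighted inequality between arithmetic and
  geometric mean of \<open>b\<close> and \<open>a\<close>, with weights \<open>p\<close> and \<open>1 - p\<close>.\<close>

lemma powr_le_tangent:
  fixes a b p :: real
  assumes "0 < p" "p < 1" "0 < a" "0 < b"
  shows "b powr p \<le> a powr p + p * a powr (p - 1) * (b - a)"
proof -
  have "b powr p * a powr (1 - p) \<le> p * b + (1 - p) * a"
    using Youngs_inequality_0[of p "1 - p" b a] assms by simp
  then have "(b powr p * a powr (1 - p)) * a powr (p - 1) \<le> (p * b + (1 - p) * a) * a powr (p - 1)"
    by (rule mult_right_mono) simp
  also have "\<dots> = a * a powr (p - 1) + p * a powr (p - 1) * (b - a)"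
    by (simp add: algebra_simps)
  also have "a * a powr (p - 1) = a powr p"
    using powr_add[of a 1 "p - 1"] assms by simp
  also have "(b powr p * a powr (1 - p)) * a powr (p - 1) = b powr p"
    using assms by (simp add: mult.assoc flip: powr_add)
  finally show ?thesis .
qed

lemma irl1_step_decrease:
  fixes f Q :: "real^'n \<Rightarrow> real"
  assumes p: "0 < p" "p < 1" and lam: "0 < lam"
    and f: "has_continuous_gradient f gf" "lipschitz_on Lf UNIV gf"
    and Q: "has_continuous_gradient Q gQ" "strongly_convex_on UNIV M Q"
    and match: "gQ x = gf x"
    and e: "\<And>i. 0 < e $ i" "\<And>i. 0 < e' $ i" "\<And>i. e' $ i \<le> e $ i"
    and min: "is_arg_min (\<lambda>y. Q y + lam * (\<Sum>i\<in>UNIV. irl1_weight p (x $ i) (e $ i) * \<bar>y $ i\<bar>))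
      (\<lambda>_. True) y"
  shows "lp_objective_eps f lam p y e' \<le> lp_objective_eps f lam p x e - (M - Lf / 2) * (norm (y - x))\<^sup>2"
proof -
  let ?w = "\<lambda>i. irl1_weight p (x $ i) (e $ i)"
  let ?R = "\<lambda>y. \<Sum>i\<in>UNIV. ?w i * \<bar>y $ i\<bar>"
  have w: "0 \<le> ?w i" for i
    using p by (simp add: irl1_weight_def)
  have "f y \<le> f x + inner (gf x) (y - x) + Lf / 2 * (norm (y - x))\<^sup>2"
    by (rule lipschitz_gradient_upper_bound[OF f])
  moreover have "Q x + inner (gf x) (y - x) + M / 2 * (norm (y - x))\<^sup>2 \<le> Q y"
    using strongly_convex_gradient_inequality[OF Q(2,1), of x y] match by simp
  moreover have "Q y + lam * ?R y + M / 2 * (norm (x - y))\<^sup>2 \<le> Q x + lam * ?R x"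
    using lam w
    by (intro strongly_convex_quadratic_growth_at_minimizer[OF _ min]
        strongly_convex_on_add_convex Q convex_on_weighted_l1) auto
  ultimately have smooth:
      "f y \<le> f x + lam * (?R x - ?R y) - (M - Lf / 2) * (norm (y - x))\<^sup>2"
    by (simp add: norm_minus_commute algebra_simps)
  have "(\<Sum>i\<in>UNIV. (\<bar>y $ i\<bar> + e' $ i) powr p)
      \<le> (\<Sum>i\<in>UNIV. (\<bar>x $ i\<bar> + e $ i) powr p + (?w i * \<bar>y $ i\<bar> - ?w i * \<bar>x $ i\<bar>))"
  proof (rule sum_mono)
    fix i
    have "(\<bar>y $ i\<bar> + e' $ i) powr p \<le> (\<bar>y $ i\<bar> + e $ i) powr p"
      using p e[of i] by (intro powr_mono2) auto
    also have "\<dots> \<le> (\<bar>x $ i\<bar> + e $ i) powr p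
        + p * (\<bar>x $ i\<bar> + e $ i) powr (p - 1) * ((\<bar>y $ i\<bar> + e $ i) - (\<bar>x $ i\<bar> + e $ i))"
      using p e(1)[of i] by (intro powr_le_tangent) (auto intro: add_nonneg_pos)
    finally show "(\<bar>y $ i\<bar> + e' $ i) powr p
        \<le> (\<bar>x $ i\<bar> + e $ i) powr p + (?w i * \<bar>y $ i\<bar> - ?w i * \<bar>x $ i\<bar>)"
      by (simp add: irl1_weight_def right_diff_distrib)
  qed
  then have "(\<Sum>i\<in>UNIV. (\<bar>y $ i\<bar> + e' $ i) powr p)
      \<le> (\<Sum>i\<in>UNIV. (\<bar>x $ i\<bar> + e $ i) powr p) + (?R y - ?R x)"
    by (simp add: sum.distrib sum_subtractf)
  then have "lam * (\<Sum>i\<in>UNIV. (\<bar>y $ i\<bar> + e' $ i) powr p)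
      \<le> lam * ((\<Sum>i\<in>UNIV. (\<bar>x $ i\<bar> + e $ i) powr p) + (?R y - ?R x))"
    using lam by (intro mult_left_mono) auto
  with smooth show ?thesis
    by (simp add: lp_objective_eps_def algebra_simps)
qed

lemma lp_objective_le_lp_objective_eps:
  assumes "0 < p" "0 \<le> lam" "\<And>i. 0 \<le> e $ i"
  shows "lp_objective f lam p x \<le> lp_objective_eps f lam p x e"
  using assms unfolding lp_objective_def lp_objective_eps_def
  by (intro add_left_mono mult_left_mono sum_mono powr_mono2) auto

lemma le_lp_objective_eps:
  assumes "0 \<le> lam"
  shows "f x \<le> lp_objective_eps f lam p x e"
  using assms by (simp add: lp_objective_eps_def sum_nonneg)

section \<open>Sequences\<close>

text \<open>A decreasing sequence that is bounded below converges, so its decrements, which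
  dominate \<open>c * (d k)\<^sup>2\<close>, vanish.\<close>

lemma sufficient_decrease_imp_tendsto_0:
  fixes F d :: "nat \<Rightarrow> real"
  assumes dec: "\<And>k. F (Suc k) \<le> F k - c * (d k)\<^sup>2" and c: "0 < c" and low: "\<And>k. b \<le> F k"
  shows "d \<longlonglongrightarrow> 0"
proof -
  have "decseq F"
  proof (rule decseq_SucI)
    fix k
    have "0 \<le> c * (d k)\<^sup>2" using c by simp
    then show "F (Suc k) \<le> F k" using dec[of k] by linarith
  qed
  then obtain l where l: "F \<longlonglongrightarrow> l"
    using decseq_convergent[of F b] low by blast
  have "(\<lambda>k. (F k - F (Suc k)) / c) \<longlonglongrightarrow> (l - l) / c"
    using c by (intro tendsto_divide tendsto_diff tendsto_const l LIMSEQ_Suc[OF l]) auto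
  then have lim: "(\<lambda>k. (F k - F (Suc k)) / c) \<longlonglongrightarrow> 0" by simp
  have "\<forall>k. norm ((d k)\<^sup>2) \<le> (F k - F (Suc k)) / c"
    using dec c by (simp add: le_divide_eq mult.commute le_diff_eq add.commute)
  then have "(\<lambda>k. (d k)\<^sup>2) \<longlonglongrightarrow> 0"
    by (rule Lim_null_comparison[OF always_eventually lim])
  then have "(\<lambda>k. sqrt ((d k)\<^sup>2)) \<longlonglongrightarrow> sqrt 0"
    by (rule tendsto_real_sqrt)
  then show ?thesis
    by (simp add: tendsto_rabs_zero_iff)
qed

lemma geometric_decay_tendsto_0:
  fixes a :: "nat \<Rightarrow> real"
  assumes "0 \<le> mu" "mu < 1" "\<And>k. 0 \<le> a k" "\<And>k. a (Suc k) \<le> mu * a k"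
  shows "a \<longlonglongrightarrow> 0"
proof -
  have "a k \<le> mu ^ k * a 0" for k
  proof (induction k)
    case (Suc k)
    have "a (Suc k) \<le> mu * a k" by (rule assms)
    also have "\<dots> \<le> mu * (mu ^ k * a 0)" using Suc assms by (intro mult_left_mono)
    finally show ?case by simp
  qed simp
  then have "\<forall>k. norm (a k) \<le> mu ^ k * a 0"
    using assms(3) by simp
  moreover have "(\<lambda>k. mu ^ k * a 0) \<longlonglongrightarrow> 0"
    using assms(1,2) by (intro tendsto_mult_left_zero LIMSEQ_power_zero) auto
  ultimately show ?thesis
    by (rule Lim_null_comparison[OF always_eventually])
qed

lemma eventually_constant_if_only_vanishing:
  fixes s :: "nat \<Rightarrow> 'a::zero"
  assumes "\<forall>\<^sub>F k in sequentially. s (Suc k) = 0 \<or> s (Suc k) = s k"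
  shows "\<exists>c. \<forall>\<^sub>F k in sequentially. s k = c"
proof -
  obtain K where K: "\<And>k. K \<le> k \<Longrightarrow> s (Suc k) = 0 \<or> s (Suc k) = s k"
    using assms by (auto simp: eventually_sequentially)
  show ?thesis
  proof (cases "\<exists>N\<ge>K. s N = 0")
    case True
    then obtain N where N: "K \<le> N" "s N = 0" by blast
    have "s k = 0" if "N \<le> k" for k
      using that
    proof (induction k rule: dec_induct)
      case (step n)
      then show ?case using K[of n] N(1) by auto
    qed (rule N(2))
    then show ?thesis by (auto simp: eventually_sequentially)
  next
    case False
    have "s k = s K" if "K \<le> k" for k
      using that
    proof (induction k rule: dec_induct)
      case (step n)
      then show ?case using K[of n] False by (metis le_SucI)
    qed simp
    then show ?thesis by (auto simp: eventually_sequentially)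
  qed
qed

section \<open>Stabilisation of the signs\<close>

lemma powr_le_imp_bounded_away_from_0:
  fixes a b q :: real
  assumes "q < 0" "0 < a" "0 < b" "a powr q \<le> b"
  shows "b powr (1 / q) \<le> a"
proof (rule ccontr)
  assume "\<not> b powr (1 / q) \<le> a"
  then have "(b powr (1 / q)) powr q < a powr q"
    using assms by (intro powr_less_mono2_neg) auto
  then show False using assms by (simp add: powr_powr)
qed

theorem theorem2p5:
  fixes f :: "real^'n \<Rightarrow> real" and gf :: "real^'n \<Rightarrow> real^'n"
    and Q :: "nat \<Rightarrow> real^'n \<Rightarrow> real" and gQ :: "nat \<Rightarrow> real^'n \<Rightarrow> real^'n"
    and x e :: "nat \<Rightarrow> real^'n"
    and p lam mu Lf M L :: real
  assumes "0 < p" and "p < 1" and "0 < lam"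
    and "has_continuous_gradient f gf"
    and "0 \<le> Lf" and "lipschitz_on Lf UNIV gf"
    and "bounded {y. lp_objective f lam p y \<le> lp_objective_eps f lam p (x 0) (e 0)}"
    and "irl1_sequence lam p mu Q gQ x e"
    and "\<And>k. gQ k (x k) = gf (x k)"
    and "0 < M" and "Lf / 2 < M"
    and "\<And>k. strongly_convex_on UNIV M (Q k)"
    and "0 < L" and "\<And>k. lipschitz_on L UNIV (gQ k)"
  shows "\<exists>kbar. \<exists>s :: real^'n. (\<forall>i. s $ i \<in> {-1, 0, 1}) \<and> (\<forall>k>kbar. sign_vec (x k) = s)"
proof -
  note p = assms(1,2) and lam = assms(3) and gradf = assms(4) and lipf = assms(6)
    and run = assms(8) and match = assms(9) and sc = assms(12) and lipQ = assms(14)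
  define F where "F k = lp_objective_eps f lam p (x k) (e k)" for k
  have gradQ: "has_continuous_gradient (Q k) (gQ k)" for k
    using run by (simp add: irl1_sequence_def)
  have min: "is_arg_min
      (\<lambda>y. Q k y + lam * (\<Sum>i\<in>UNIV. irl1_weight p (x k $ i) (e k $ i) * \<bar>y $ i\<bar>))
      (\<lambda>_. True) (x (Suc k))" for k
    using run by (simp add: irl1_sequence_def)
  have mu: "0 < mu" "mu < 1" and e_Suc: "e (Suc k) $ i \<le> mu * e k $ i" for k i
    using run by (auto simp: irl1_sequence_def)
  have e_pos: "0 < e k $ i" for k i
    using run by (cases k) (auto simp: irl1_sequence_def)
  have e_dec: "e (Suc k) $ i \<le> e k $ i" for k i
  proof -
    have "mu * e k $ i \<le> 1 * e k $ i"
      using mu e_pos[of k i] by (intro mult_right_mono) auto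
    then show ?thesis using e_Suc[of k i] by simp
  qed
  have e_lim: "(\<lambda>k. e k $ i) \<longlonglongrightarrow> 0" for i
    using mu e_Suc less_imp_le[OF e_pos] by (intro geometric_decay_tendsto_0[of mu]) auto

  have F_dec: "F (Suc k) \<le> F k - (M - Lf / 2) * (norm (x (Suc k) - x k))\<^sup>2" for k
    unfolding F_def
    by (rule irl1_step_decrease[OF p lam gradf lipf gradQ sc match e_pos e_pos e_dec min])
  have "decseq F"
  proof (rule decseq_SucI)
    fix k
    have "0 \<le> (M - Lf / 2) * (norm (x (Suc k) - x k))\<^sup>2" using assms(11) by simp
    then show "F (Suc k) \<le> F k" using F_dec[of k] by linarith
  qed
  then have F_le: "F k \<le> F 0" for k by (simp add: decseqD)
  have "x k \<in> {y. lp_objective f lam p y \<le> lp_objective_eps f lam p (x 0) (e 0)}" for k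
    using lp_objective_le_lp_objective_eps[of p lam "e k" f "x k"] F_le[of k] p lam e_pos
    by (auto simp: F_def intro: less_imp_le order_trans)
  then have "bounded (range x)"
    by (intro bounded_subset[OF assms(7)]) auto
  then obtain B where B: "0 < B" "\<And>k. norm (x k) \<le> B"
    by (auto simp: bounded_pos)

  obtain y where y: "\<forall>z\<in>cball 0 B. f y \<le> f z"
    using continuous_attains_inf[OF compact_cball _ has_continuous_gradient_imp_continuous_on[OF gradf],
        of 0 B] B(1) by auto
  have F_low: "f y \<le> F k" for k
    using bspec[OF y, of "x k"] B(2)[of k] le_lp_objective_eps[of lam f "x k" p "e k"] lam by (simp add: F_def)
  have step_lim: "(\<lambda>k. norm (x (Suc k) - x k)) \<longlonglongrightarrow> 0"
    using assms(11)
    by (intro sufficient_decrease_imp_tendsto_0[where F = F and c = "M - Lf / 2", OF F_dec _ F_low]) simp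

  define C where "C = norm (gf 0) + Lf * B + L * (2 * B)"
  have gQ_bound: "norm (gQ k z) \<le> C" if "norm z \<le> B" for k z
  proof -
    have "norm (gf (x k) - gf 0) \<le> Lf * norm (x k - 0)"
      using lipschitz_onD[OF lipf, of "x k" 0] by (simp add: dist_norm)
    also have "\<dots> \<le> Lf * B" using B assms(5) by (intro mult_left_mono) auto
    finally have 1: "norm (gf (x k) - gf 0) \<le> Lf * B" .
    have "norm (gQ k z - gQ k (x k)) \<le> L * norm (z - x k)"
      using lipschitz_onD[OF lipQ, of z "x k"] by (simp add: dist_norm)
    also have "\<dots> \<le> L * (2 * B)"
      using norm_triangle_ineq4[of z "x k"] B(2)[of k] that assms(13) by (intro mult_left_mono) auto
    finally have 2: "norm (gQ k z - gQ k (x k)) \<le> L * (2 * B)" .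
    have "norm (gQ k z) \<le> norm (gf 0) + norm (gf (x k) - gf 0) + norm (gQ k z - gQ k (x k))"
      using norm_triangle_sub[of "gQ k z" "gQ k (x k)"] norm_triangle_sub[of "gf (x k)" "gf 0"]
      by (simp add: match)
    with 1 2 show ?thesis by (simp add: C_def)
  qed
  have "0 < C"
    using B(1) assms(5,13) by (simp add: C_def add_nonneg_pos)
  (* lam times the weight exceeds the gradient bound C once the smoothed modulus is below \<delta>. *)
  define \<delta> where "\<delta> = (C / (lam * p)) powr (1 / (p - 1))"
  have "0 < \<delta>"
    using \<open>0 < C\<close> p lam by (simp add: \<delta>_def)
  have away: "\<delta> \<le> \<bar>x k $ i\<bar> + e k $ i" if nz: "x (Suc k) $ i \<noteq> 0" for k i
  proof -
    obtain z where z: "norm z \<le> norm (x (Suc k))"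
      "lam * irl1_weight p (x k $ i) (e k $ i) \<le> norm (gQ k z)"
      using l1_minimizer_nonzero_weight_bound[OF sc less_imp_le[OF assms(10)] gradQ min nz] by metis
    have "lam * irl1_weight p (x k $ i) (e k $ i) \<le> C"
      using z gQ_bound[of z k] B(2)[of "Suc k"] by linarith
    then have "(\<bar>x k $ i\<bar> + e k $ i) powr (p - 1) \<le> C / (lam * p)"
      using p lam by (simp add: irl1_weight_def le_divide_eq mult_ac)
    then show ?thesis
      unfolding \<delta>_def using p lam \<open>0 < C\<close> e_pos[of k i]
      by (intro powr_le_imp_bounded_away_from_0) (auto intro: add_nonneg_pos)
  qed

  have "\<forall>\<^sub>F k in sequentially. sgn (x (Suc k) $ i) = 0 \<or> sgn (x (Suc k) $ i) = sgn (x k $ i)" for i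
  proof -
    have "\<forall>\<^sub>F k in sequentially. e k $ i < \<delta> / 2"
      using \<open>0 < \<delta>\<close> by (intro order_tendstoD(2)[OF e_lim]) simp
    moreover have "\<forall>\<^sub>F k in sequentially. norm (x (Suc k) - x k) < \<delta> / 2"
      using \<open>0 < \<delta>\<close> by (intro order_tendstoD(2)[OF step_lim]) simp
    ultimately show ?thesis
    proof eventually_elim
      case (elim k)
      show ?case
      proof (cases "x (Suc k) $ i = 0")
        case False
        (* The component moves by less than its distance from zero. *)
        have "\<bar>x (Suc k) $ i - x k $ i\<bar> < \<bar>x k $ i\<bar>"
          using away[OF False] elim component_le_norm_cart[of "x (Suc k) - x k" i] by simp
        then show ?thesis by (auto simp: sgn_if)
      qed simp
    qed
  qed
  then have "\<exists>c. \<forall>\<^sub>F k in sequentially. sgn (x k $ i) = c" for i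
    by (rule eventually_constant_if_only_vanishing)
  then obtain c where c: "\<And>i. \<forall>\<^sub>F k in sequentially. sgn (x k $ i) = c i"
    by metis
  then have "\<forall>\<^sub>F k in sequentially. \<forall>i. sgn (x k $ i) = c i"
    by (rule eventually_all_finite)
  then obtain N where N: "\<And>k i. N \<le> k \<Longrightarrow> sgn (x k $ i) = c i"
    by (auto simp: eventually_sequentially)
  show ?thesis
  proof (intro exI conjI allI impI)
    show "sign_vec (x k) = sign_vec (x N)" if "N < k" for k
      using N[of k] N[of N] that by (simp add: sign_vec_def)
    show "sign_vec (x N) $ i \<in> {-1, 0, 1}" for i
      by (simp add: sign_vec_def sgn_if)
  qed
qed

end
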